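(* Let $K \subset \mathbb{R}^d$ be a centrally symmetric convex body with centre of symmetry $O$. Let $X, X'$ be uniformly distributed random points in $K$, and let $Y_O, Y_O'$ be random points having the projective distribution on $\partial K$ with centre of projection $O$, all independent. Then $$\mathbb{E}|XX'|^2 = \frac{d}{d+1}\,\mathbb{E}|XY_O|^2 = \frac{2d}{d+2}\,\mathbb{E}|OY_O|^2 = \frac{d}{d+2}\,\mathbb{E}|Y_OY_O'|^2.$$
   Context: A convex body is a convex compact set with non-empty interior. "Uniform in $K$" is with respect to Lebesgue measure. $|AB|$ denotes Euclidean distance. Projective distribution with centre $O$: the distribution of the random boundary point obtained by taking a uniformly distributed random point $Z$ in $K$ and replacing $Z \ne O$ by the unique point where the ray from $O$ through $Z$ meets $\partial K$. *)

theory Defs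
  imports "HOL-Probability.Probability"
begin

definition convex_body :: "'a::euclidean_space set \<Rightarrow> bool" where
  "convex_body K \<longleftrightarrow> convex K \<and> compact K \<and> interior K \<noteq> {}"

definition centrally_symmetric_about :: "'a::euclidean_space \<Rightarrow> 'a set \<Rightarrow> bool" where
  "centrally_symmetric_about c K \<longleftrightarrow> (\<lambda>x. 2 *\<^sub>R c - x) ` K = K"

(* The description by THE is meaningful when K is a convex body with c in its interior.
   The value at z = c affects only a Lebesgue null set. *)
definition radial_projection :: "'a::euclidean_space \<Rightarrow> 'a set \<Rightarrow> 'a \<Rightarrow> 'a" where
  "radial_projection c K z =
     (if z = c then c
      else (THE p. p \<in> frontier K \<and> (\<exists>t\<ge>0. p = c + t *\<^sub>R (z - c))))"

definition projective_distribution :: "'a::euclidean_space \<Rightarrow> 'a set \<Rightarrow> 'a measure" where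
  "projective_distribution c K =
     distr (uniform_measure lborel K) borel (radial_projection c K)"

end

theory Submission
  imports Defs
begin

text \<open>Let \<open>g\<close> be the Minkowski gauge of \<open>K\<close> about \<open>c\<close>, so that \<open>z - c = g z (\<rho> z - c)\<close> for the radial
  projection \<open>\<rho>\<close>, which is constant on rays. The sublevel set \<open>{g \<le> s}\<close> is \<open>K\<close> scaled by \<open>s\<close>, so for every function
  \<open>f\<close> constant on rays its integral over \<open>{g \<le> s}\<close> is \<open>s\<^sup>d\<close> times the one over \<open>K\<close>. Integrating in \<open>s\<close> with
  \<open>f = |\<rho> - c|\<^sup>2\<close> yields \<open>E|X - c|\<^sup>2 = d / (d + 2) E|Y - c|\<^sup>2\<close>. By symmetry all four points have mean \<open>c\<close>,
  so by independence \<open>E|U - V|\<^sup>2 = E|U - c|\<^sup>2 + E|V - c|\<^sup>2\<close> for any two of them.\<close>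

section \<open>Rays from an interior point, and dilations about a point\<close>

text \<open>A ray from \<open>c\<close> leaves the bounded set \<open>K\<close> through a frontier
  point at some parameter \<open>r\<close>. By convexity nothing beyond it lies in \<open>K\<close>,
  and everything before it is interior. So the \<open>THE\<close> in the definition has exactly one
  candidate.\<close>

lemma radial_projection_ray:
  fixes K :: "'a::euclidean_space set"
  assumes K: "convex K" "compact K" and c: "c \<in> interior K" and z: "z \<noteq> c"
  obtains r where "r > 0" "radial_projection c K z = c + r *\<^sub>R (z - c)"
    "\<And>s. s \<ge> 0 \<Longrightarrow> c + s *\<^sub>R (z - c) \<in> K \<longleftrightarrow> s \<le> r"
proof -
  have closed: "closed K" using K(2) by (rule compact_imp_closed)
  obtain r where r: "0 < r" "c + r *\<^sub>R (z - c) \<in> frontier K"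
      "\<And>s. 0 \<le> s \<Longrightarrow> s < r \<Longrightarrow> c + s *\<^sub>R (z - c) \<in> interior K"
    using ray_to_frontier[OF compact_imp_bounded[OF K(2)] c, of "z - c"] z by auto
  have front: "frontier K = K - interior K"
    using closed by (simp add: frontier_def)
  have le: "s \<le> r" if s: "s \<ge> 0" "c + s *\<^sub>R (z - c) \<in> K" for s
  proof (rule ccontr)
    assume "\<not> s \<le> r"
    then have sr: "r < s" by simp
    \<comment> \<open>Shrinking towards \<open>c\<close> by the factor \<open>1 - ?e = r / s\<close>
      moves the point at parameter \<open>s\<close> to the frontier point at parameter
      \<open>r\<close>, which would then be interior.\<close>
    let ?e = "1 - r / s"
    have "(c + s *\<^sub>R (z - c)) - ?e *\<^sub>R ((c + s *\<^sub>R (z - c)) - c) \<in> interior K"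
      by (rule mem_interior_convex_shrink[OF K(1) c s(2)]) (use sr r(1) in auto)
    also have "(c + s *\<^sub>R (z - c)) - ?e *\<^sub>R ((c + s *\<^sub>R (z - c)) - c) = c + (s - ?e * s) *\<^sub>R (z - c)"
      by (simp add: algebra_simps)
    also have "s - ?e * s = r" using sr r(1) by (simp add: field_simps)
    finally show False using r(2) front by auto
  qed
  have mem: "c + s *\<^sub>R (z - c) \<in> K \<longleftrightarrow> s \<le> r" if "s \<ge> 0" for s
    using le[OF that] r(2) r(3)[OF that] front interior_subset[of K] by fastforce
  have "radial_projection c K z = (THE p. p \<in> frontier K \<and> (\<exists>t\<ge>0. p = c + t *\<^sub>R (z - c)))"
    using z by (simp add: radial_projection_def)
  also have "\<dots> = c + r *\<^sub>R (z - c)"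
  proof (rule the_equality)
    show "c + r *\<^sub>R (z - c) \<in> frontier K \<and> (\<exists>t\<ge>0. c + r *\<^sub>R (z - c) = c + t *\<^sub>R (z - c))"
      using r by (auto intro!: exI[of _ r])
  next
    fix p assume "p \<in> frontier K \<and> (\<exists>t\<ge>0. p = c + t *\<^sub>R (z - c))"
    then obtain t where t: "t \<ge> 0" "p = c + t *\<^sub>R (z - c)" "p \<in> K" "p \<notin> interior K"
      using front by auto
    have "t \<le> r" using t mem[of t] by simp
    moreover have "\<not> t < r" using t r(3)[of t] by auto
    ultimately have "t = r" by simp
    then show "p = c + r *\<^sub>R (z - c)" using t by simp
  qed
  finally show thesis using that r(1) mem by blast
qed

text \<open>Change of variables by an affine map with factor \<open>s\<close>; the translation part
  \<open>c - s *\<^sub>R c\<close> is chosen so that the map fixes \<open>c\<close>.\<close>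

lemma nn_integral_lborel_dilation:
  fixes h :: "'a::euclidean_space \<Rightarrow> ennreal" and c :: 'a
  assumes [measurable]: "h \<in> borel_measurable borel" and s: "s \<noteq> 0"
  shows "(\<integral>\<^sup>+z. h z \<partial>lborel) = ennreal (\<bar>s\<bar> ^ DIM('a)) * (\<integral>\<^sup>+z. h (c + s *\<^sub>R (z - c)) \<partial>lborel)"
proof -
  have "(\<integral>\<^sup>+z. h z \<partial>lborel)
      = (\<integral>\<^sup>+z. h z \<partial>density (distr lborel borel (\<lambda>x. (c - s *\<^sub>R c) + s *\<^sub>R x)) (\<lambda>_. ennreal (\<bar>s\<bar> ^ DIM('a))))"
    using lborel_affine[OF s, of "c - s *\<^sub>R c"] by simp
  also have "\<dots> = ennreal (\<bar>s\<bar> ^ DIM('a)) * (\<integral>\<^sup>+z. h ((c - s *\<^sub>R c) + s *\<^sub>R z) \<partial>lborel)"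
    by (simp add: nn_integral_density nn_integral_distr nn_integral_cmult)
  also have "(\<lambda>z. (c - s *\<^sub>R c) + s *\<^sub>R z) = (\<lambda>z. c + s *\<^sub>R (z - c))"
    by (simp add: algebra_simps fun_eq_iff)
  then have "(\<lambda>z. h ((c - s *\<^sub>R c) + s *\<^sub>R z)) = (\<lambda>z. h (c + s *\<^sub>R (z - c)))"
    by metis
  finally show ?thesis by simp
qed

section \<open>The Minkowski gauge about an interior point\<close>

text \<open>For a compact convex \<open>K\<close> with \<open>c\<close> in its interior this is the
  infimum of the \<open>t > 0\<close> for which \<open>z\<close> lies in the copy of
  \<open>K\<close> dilated by \<open>t\<close> about \<open>c\<close>. The quotient form ties it
  directly to the radial projection, and at \<open>z = c\<close> it reads 0 / 0 = 0.\<close>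

definition minkowski_gauge :: "'a::euclidean_space \<Rightarrow> 'a set \<Rightarrow> 'a \<Rightarrow> real" where
  "minkowski_gauge c K z = norm (z - c) / norm (radial_projection c K z - c)"

locale centred_convex_body =
  fixes K :: "'a::euclidean_space set" and c :: 'a
  assumes convex_K: "convex K" and compact_K: "compact K" and c_interior: "c \<in> interior K"
begin

abbreviation g where "g \<equiv> minkowski_gauge c K"
abbreviation \<rho> where "\<rho> \<equiv> radial_projection c K"

lemma closed_K: "closed K"
  using compact_K by (rule compact_imp_closed)

lemma K_borel [measurable]: "K \<in> sets borel"
  using closed_K by (rule borel_closed)

lemma c_in_K: "c \<in> K"
  using c_interior interior_subset by blast

text \<open>For \<open>z \<noteq> c\<close> the gauge is the reciprocal of the exit parameter of the
  ray through \<open>z\<close>. The formula for \<open>\<rho>\<close> survives at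
  \<open>z = c\<close>, where the vector being scaled is zero.\<close>

lemma gauge_pos: "z \<noteq> c \<Longrightarrow> 0 < g z"
  and radial_projection_eq: "\<rho> z = c + (1 / g z) *\<^sub>R (z - c)"
  and gauge_ray: "z \<noteq> c \<Longrightarrow> s \<ge> 0 \<Longrightarrow> c + s *\<^sub>R (z - c) \<in> K \<longleftrightarrow> s \<le> 1 / g z"
proof -
  have *: "0 < g z \<and> \<rho> z = c + (1 / g z) *\<^sub>R (z - c) \<and>
      (\<forall>s\<ge>0. c + s *\<^sub>R (z - c) \<in> K \<longleftrightarrow> s \<le> 1 / g z)" if z: "z \<noteq> c" for z
  proof -
    obtain r where r: "r > 0" "\<rho> z = c + r *\<^sub>R (z - c)"
      "\<And>s. s \<ge> 0 \<Longrightarrow> c + s *\<^sub>R (z - c) \<in> K \<longleftrightarrow> s \<le> r"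
      using radial_projection_ray[OF convex_K compact_K c_interior z] by blast
    have "g z = 1 / r" using z r(1,2) by (simp add: minkowski_gauge_def)
    then show ?thesis using r by simp
  qed
  show "z \<noteq> c \<Longrightarrow> 0 < g z" using * by blast
  show "\<rho> z = c + (1 / g z) *\<^sub>R (z - c)"
    using * by (cases "z = c") (auto simp: radial_projection_def)
  show "z \<noteq> c \<Longrightarrow> s \<ge> 0 \<Longrightarrow> c + s *\<^sub>R (z - c) \<in> K \<longleftrightarrow> s \<le> 1 / g z"
    using * by blast
qed

lemma gauge_center [simp]: "g c = 0"
  by (simp add: minkowski_gauge_def)

lemma gauge_nonneg [simp]: "0 \<le> g z"
  using gauge_pos[of z] by (cases "z = c") auto

text \<open>Sublevel sets of \<open>g\<close> are dilated copies of \<open>K\<close>. Scaling,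
  measurability and reflection of \<open>g\<close> are all reduced to membership in \<open>K\<close>
  through this.\<close>

lemma gauge_le_iff:
  assumes "t > 0" shows "g z \<le> t \<longleftrightarrow> c + (1 / t) *\<^sub>R (z - c) \<in> K"
proof (cases "z = c")
  case False
  show ?thesis
    using gauge_ray[OF False, of "1 / t"] gauge_pos[OF False] assms by (simp add: field_simps)
qed (use assms c_in_K in auto)

lemma gauge_le_1_iff: "g z \<le> 1 \<longleftrightarrow> z \<in> K"
  using gauge_le_iff[of 1 z] by simp

lemma gauge_scale:
  assumes s: "s > 0" shows "g (c + s *\<^sub>R (z - c)) = s * g z"
proof (cases "z = c")
  case False
  have le: "g (c + s *\<^sub>R (z - c)) \<le> t \<longleftrightarrow> s * g z \<le> t" if "t > 0" for t
    using gauge_le_iff[OF that, of "c + s *\<^sub>R (z - c)"] gauge_le_iff[of "t / s" z] that s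
    by (simp add: field_simps)
  have "0 < s * g z" "0 < g (c + s *\<^sub>R (z - c))"
    using gauge_pos False s by auto
  \<comment> \<open>Two positive numbers with the same positive upper bounds are equal, each being
    an upper bound of itself.\<close>
  then show ?thesis using le by (meson order.antisym order_refl)
qed simp

lemma radial_projection_scale:
  assumes "s > 0" shows "\<rho> (c + s *\<^sub>R (z - c)) = \<rho> z"
  using assms by (simp add: radial_projection_eq gauge_scale)

lemma radial_projection_in_K: "\<rho> z \<in> K"
proof (cases "z = c")
  case False
  then show ?thesis
    using gauge_ray[OF False, of "1 / g z"] by (simp add: radial_projection_eq[of z])
qed (simp add: radial_projection_def c_in_K)

lemma gauge_measurable [measurable]: "g \<in> borel_measurable borel"
proof (rule borel_measurableI_le)
  fix t
  show "{z \<in> space borel. g z \<le> t} \<in> sets borel"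
  proof (cases "t > 0")
    case True
    have "(\<lambda>z. c + (1 / t) *\<^sub>R (z - c)) -` K \<inter> space borel \<in> sets borel"
      by measurable
    moreover have "{z \<in> space borel. g z \<le> t} = (\<lambda>z. c + (1 / t) *\<^sub>R (z - c)) -` K \<inter> space borel"
      using gauge_le_iff[OF True] by auto
    ultimately show ?thesis by simp
  next
    case False
    \<comment> \<open>Away from \<open>c\<close> the gauge is positive, so a level
      \<open>t \<le> 0\<close> can be reached only at \<open>c\<close>.\<close>
    have "g z \<le> t \<longleftrightarrow> t = 0 \<and> z = c" for z
      using False gauge_pos[of z] by (cases "z = c") auto
    then have "{z \<in> space borel. g z \<le> t} = (if t = 0 then {c} else {})"
      by auto
    then show ?thesis by simp
  qed
qed

text \<open>Measurability is hard to see from a description by \<open>THE\<close>; the explicit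
  formula reduces it to that of \<open>g\<close>.\<close>

lemma radial_projection_measurable [measurable]: "\<rho> \<in> borel_measurable borel"
proof -
  have "\<rho> = (\<lambda>z. c + (1 / g z) *\<^sub>R (z - c))" by (simp add: radial_projection_eq fun_eq_iff)
  then show ?thesis by simp
qed

text \<open>The weight \<open>1 - g\<^sup>2\<close> is the integral of \<open>2 s\<close> over \<open>s \<in> [g, 1]\<close>; after swapping the
  integrals, the sublevel set of \<open>g\<close> at \<open>s\<close> is a copy of \<open>K\<close> scaled by \<open>s\<close>.\<close>

lemma nn_integral_one_minus_gauge_square:
  fixes f :: "'a \<Rightarrow> ennreal"
  assumes f [measurable]: "f \<in> borel_measurable borel"
    and hom: "\<And>s z. s > 0 \<Longrightarrow> f (c + s *\<^sub>R (z - c)) = f z"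
  shows "(\<integral>\<^sup>+z\<in>K. f z * ennreal (1 - (g z)\<^sup>2) \<partial>lborel)
      = ennreal (2 / (real DIM('a) + 2)) * (\<integral>\<^sup>+z\<in>K. f z \<partial>lborel)"
proof -
  let ?F = "\<integral>\<^sup>+z\<in>K. f z \<partial>lborel"
  let ?w = "\<lambda>z s. if g z \<le> s \<and> s \<le> 1 then ennreal (2 * s) else 0"
  have inner: "(\<integral>\<^sup>+s. ?w z s \<partial>lborel) = ennreal (1 - (g z)\<^sup>2) * indicator K z" for z
  proof (cases "z \<in> K")
    case True
    then have g1: "g z \<le> 1" by (simp add: gauge_le_1_iff)
    have "(\<integral>\<^sup>+s. ?w z s \<partial>lborel) = (\<integral>\<^sup>+s. ennreal (2 * s) * indicator {g z..1} s \<partial>lborel)"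
      by (intro nn_integral_cong) (auto simp: indicator_def)
    also have "\<dots> = ennreal (1\<^sup>2 - (g z)\<^sup>2)"
      by (rule nn_integral_FTC_Icc)
         (use g1 gauge_nonneg[of z] in \<open>auto intro!: derivative_eq_intros simp del: gauge_nonneg\<close>)
    finally show ?thesis using True by simp
  next
    case False
    then have "\<not> g z \<le> 1" by (simp add: gauge_le_1_iff)
    then have "?w z = (\<lambda>s. 0)" by auto
    then show ?thesis using False by simp
  qed
  have scale: "(\<integral>\<^sup>+z. f z * indicator {z. g z \<le> s} z \<partial>lborel) = ennreal (s ^ DIM('a)) * ?F"
    if s: "s > 0" for s
  proof -
    have "(\<integral>\<^sup>+z. f z * indicator {z. g z \<le> s} z \<partial>lborel) =
        ennreal (\<bar>s\<bar> ^ DIM('a)) * (\<integral>\<^sup>+z. f (c + s *\<^sub>R (z - c)) * indicator {z. g z \<le> s} (c + s *\<^sub>R (z - c)) \<partial>lborel)"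
      using s by (intro nn_integral_lborel_dilation) auto
    also have "(\<integral>\<^sup>+z. f (c + s *\<^sub>R (z - c)) * indicator {z. g z \<le> s} (c + s *\<^sub>R (z - c)) \<partial>lborel) = ?F"
      using s by (intro nn_integral_cong) (auto simp: hom gauge_scale indicator_def gauge_le_1_iff)
    finally show ?thesis using s by simp
  qed
  have "(\<integral>\<^sup>+z\<in>K. f z * ennreal (1 - (g z)\<^sup>2) \<partial>lborel) = (\<integral>\<^sup>+z. f z * (\<integral>\<^sup>+s. ?w z s \<partial>lborel) \<partial>lborel)"
    by (simp add: inner mult_ac)
  also have "\<dots> = (\<integral>\<^sup>+z. (\<integral>\<^sup>+s. f z * ?w z s \<partial>lborel) \<partial>lborel)"
    by (simp add: nn_integral_cmult)
  also have "\<dots> = (\<integral>\<^sup>+s. (\<integral>\<^sup>+z. f z * ?w z s \<partial>lborel) \<partial>lborel)"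
    by (rule lborel_pair.Fubini') measurable
  also have "\<dots> = (\<integral>\<^sup>+s. ?F * (ennreal (2 * s ^ (DIM('a) + 1)) * indicator {0..1} s) \<partial>lborel)"
  proof (intro nn_integral_cong)
    fix s :: real
    show "(\<integral>\<^sup>+z. f z * ?w z s \<partial>lborel) = ?F * (ennreal (2 * s ^ (DIM('a) + 1)) * indicator {0..1} s)"
    proof (cases "0 < s \<and> s \<le> 1")
      case True
      have "(\<integral>\<^sup>+z. f z * ?w z s \<partial>lborel) = (\<integral>\<^sup>+z. ennreal (2 * s) * (f z * indicator {z. g z \<le> s} z) \<partial>lborel)"
        using True by (intro nn_integral_cong) (auto simp: mult_ac)
      also have "\<dots> = ennreal (2 * s) * (ennreal (s ^ DIM('a)) * ?F)"
        using True by (simp add: nn_integral_cmult scale)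
      also have "\<dots> = ennreal (2 * s * s ^ DIM('a)) * ?F"
        using True by (simp add: ennreal_mult mult_ac)
      finally show ?thesis using True by (simp add: mult_ac)
    next
      case False
      \<comment> \<open>For \<open>s < 0\<close> or \<open>s > 1\<close> the condition fails because
        \<open>g\<close> is nonnegative; at \<open>s = 0\<close> the value \<open>2 * s\<close>
        vanishes.\<close>
      then have "?w z s = 0" for z
        using gauge_nonneg[of z] by (auto simp del: gauge_nonneg)
      then show ?thesis using False by (auto simp: indicator_def)
    qed
  qed
  also have "\<dots> = ?F * (\<integral>\<^sup>+s. ennreal (2 * s ^ (DIM('a) + 1)) * indicator {0..1} s \<partial>lborel)"
    by (simp add: nn_integral_cmult)
  \<comment> \<open>The dilation contributes the power d of \<open>s\<close> and the weight one
    more, so the antiderivative has degree d + 2 and leading constant 2 / (d + 2).\<close>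
  also have "(\<integral>\<^sup>+s. ennreal (2 * s ^ (DIM('a) + 1)) * indicator {0..1} s \<partial>lborel)
      = ennreal (2 / (real DIM('a) + 2) * 1 ^ (DIM('a) + 2) - 2 / (real DIM('a) + 2) * 0 ^ (DIM('a) + 2))"
    by (rule nn_integral_FTC_Icc)
       (auto intro!: derivative_eq_intros simp: divide_simps simp del: power_Suc)
  finally show ?thesis by (simp add: mult_ac)
qed

section \<open>The uniform distribution on \<open>K\<close> and the second moments\<close>

abbreviation \<mu> where "\<mu> \<equiv> uniform_measure lborel K"

lemma emeasure_K: "emeasure lborel K \<noteq> 0" "emeasure lborel K \<noteq> \<infinity>"
proof -
  show "emeasure lborel K \<noteq> \<infinity>"
    using emeasure_bounded_finite[OF compact_imp_bounded[OF compact_K]] by simp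
  show "emeasure lborel K \<noteq> 0"
  proof
    assume "emeasure lborel K = 0"
    then have "K \<in> null_sets lborel" by auto
    then have "negligible K" by (metis null_sets_completionI negligible_iff_null_sets)
    then show False
      using c_interior negligible_subset[OF _ interior_subset] open_not_negligible[OF open_interior, of K]
      by blast
  qed
qed

sublocale \<mu>: prob_space \<mu>
  using emeasure_K by (intro prob_space_uniform_measure) auto

lemma AE_in_K: "AE z in \<mu>. z \<in> K"
  by (rule AE_uniform_measureI) auto

lemma K_bounded_center: obtains R where "\<And>z. z \<in> K \<Longrightarrow> norm (z - c) \<le> R"
  using compact_imp_bounded[OF compact_K]
  by (auto simp: bounded_any_center[where a = c] dist_norm norm_minus_commute)

text \<open>From |z - c| = g |\<rho> - c| the difference of the two second moments is the integral
  of |\<rho> - c|^2 (1 - g^2). This is nonnegative on \<open>K\<close>, so it can be evaluated as a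
  nonnegative integral, and it equals 2 / (d + 2) times the moment of \<open>\<rho>\<close>.\<close>

lemma second_moment_radial_projection:
  "(\<integral>z. (norm (z - c))\<^sup>2 \<partial>\<mu>)
    = real DIM('a) / (real DIM('a) + 2) * (\<integral>z. (norm (\<rho> z - c))\<^sup>2 \<partial>\<mu>)"
proof -
  let ?d = "real DIM('a)"
  let ?f = "\<lambda>z. (norm (\<rho> z - c))\<^sup>2"
  obtain R where R: "\<And>z. z \<in> K \<Longrightarrow> norm (z - c) \<le> R"
    using K_bounded_center by blast
  have norm_eq: "?f z * (1 - (g z)\<^sup>2) = ?f z - (norm (z - c))\<^sup>2" for z
    using gauge_pos[of z] by (cases "z = c") (auto simp: radial_projection_eq[of z] power_divide right_diff_distrib)
  have int: "integrable \<mu> ?f" "integrable \<mu> (\<lambda>z. (norm (z - c))\<^sup>2)"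
  proof -
    show "integrable \<mu> ?f"
      using R radial_projection_in_K
      by (intro \<mu>.integrable_const_bound[where B = "R\<^sup>2"]) (simp_all add: power_mono)
    have "AE z in \<mu>. norm ((norm (z - c))\<^sup>2) \<le> R\<^sup>2"
      using AE_in_K by eventually_elim (simp add: R power_mono)
    then show "integrable \<mu> (\<lambda>z. (norm (z - c))\<^sup>2)"
      by (rule \<mu>.integrable_const_bound) simp
  qed
  have "(\<integral>z. ?f z \<partial>\<mu>) - (\<integral>z. (norm (z - c))\<^sup>2 \<partial>\<mu>) = (\<integral>z. ?f z * (1 - (g z)\<^sup>2) \<partial>\<mu>)"
    using int by (simp add: norm_eq)
  also have "\<dots> = enn2real (\<integral>\<^sup>+z. ennreal (?f z * (1 - (g z)\<^sup>2)) \<partial>\<mu>)"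
  proof (rule integral_eq_nn_integral)
    show "AE z in \<mu>. 0 \<le> ?f z * (1 - (g z)\<^sup>2)"
      using AE_in_K by eventually_elim (simp add: power_le_one gauge_le_1_iff)
  qed simp
  also have "(\<integral>\<^sup>+z. ennreal (?f z * (1 - (g z)\<^sup>2)) \<partial>\<mu>)
      = (\<integral>\<^sup>+z\<in>K. ennreal (?f z) * ennreal (1 - (g z)\<^sup>2) \<partial>lborel) / emeasure lborel K"
    by (simp add: nn_integral_uniform_measure ennreal_mult')
  also have "\<dots> = ennreal (2 / (?d + 2)) * ((\<integral>\<^sup>+z\<in>K. ennreal (?f z) \<partial>lborel) / emeasure lborel K)"
    by (subst nn_integral_one_minus_gauge_square)
       (simp_all add: radial_projection_scale ennreal_times_divide)
  also have "(\<integral>\<^sup>+z\<in>K. ennreal (?f z) \<partial>lborel) / emeasure lborel K = (\<integral>\<^sup>+z. ennreal (?f z) \<partial>\<mu>)"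
    by (simp add: nn_integral_uniform_measure)
  also have "enn2real (ennreal (2 / (?d + 2)) * (\<integral>\<^sup>+z. ennreal (?f z) \<partial>\<mu>)) = 2 / (?d + 2) * (\<integral>z. ?f z \<partial>\<mu>)"
    by (simp add: enn2real_mult integral_eq_nn_integral)
  finally show ?thesis by (simp add: field_simps)
qed

end

section \<open>Central symmetry and vanishing means\<close>

locale symmetric_convex_body = centred_convex_body +
  assumes reflect_in_K: "z \<in> K \<Longrightarrow> 2 *\<^sub>R c - z \<in> K"
begin

lemma reflect_in_K_iff: "2 *\<^sub>R c - z \<in> K \<longleftrightarrow> z \<in> K"
  using reflect_in_K[of z] reflect_in_K[of "2 *\<^sub>R c - z"] by auto

text \<open>Reflecting the point of \<open>K\<close> on the ray through \<open>z\<close> at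
  parameter \<open>1 / g z\<close> gives one inequality; the other follows because the reflection is
  an involution.\<close>

lemma gauge_reflect: "g (2 *\<^sub>R c - z) = g z"
proof (rule antisym)
  have *: "g (2 *\<^sub>R c - z) \<le> g z" for z
  proof (cases "z = c")
    case False
    then have "c + (1 / g z) *\<^sub>R (z - c) \<in> K"
      using gauge_le_iff[of "g z" z] gauge_pos by simp
    then have "2 *\<^sub>R c - (c + (1 / g z) *\<^sub>R (z - c)) \<in> K" by (rule reflect_in_K)
    also have "2 *\<^sub>R c - (c + (1 / g z) *\<^sub>R (z - c)) = c + (1 / g z) *\<^sub>R (2 *\<^sub>R c - z - c)"
      by (simp add: algebra_simps scaleR_2)
    finally show ?thesis using gauge_le_iff[of "g z" "2 *\<^sub>R c - z"] gauge_pos[OF False] by simp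
  qed (simp add: scaleR_2)
  show "g (2 *\<^sub>R c - z) \<le> g z" by (rule *)
  show "g z \<le> g (2 *\<^sub>R c - z)" using *[of "2 *\<^sub>R c - z"] by simp
qed

lemma radial_projection_reflect: "\<rho> (2 *\<^sub>R c - z) = 2 *\<^sub>R c - \<rho> z"
  unfolding radial_projection_eq gauge_reflect by (simp add: algebra_simps scaleR_2)

text \<open>Lebesgue measure is invariant under the affine map with factor -1, and the density of
  \<open>\<mu>\<close> is invariant because \<open>K\<close> is.\<close>

lemma uniform_measure_reflect: "distr \<mu> borel (\<lambda>z. 2 *\<^sub>R c - z) = \<mu>"
proof -
  let ?T = "\<lambda>z. 2 *\<^sub>R c - z"
  let ?h = "\<lambda>z. indicator K z / emeasure lborel K :: ennreal"
  have lborel: "distr lborel borel ?T = lborel"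
    using lborel_affine[of "-1" "2 *\<^sub>R c"] by (simp add: density_1)
  \<comment> \<open>The density is replaced by its composition with \<open>?T\<close>, the form in
    which it can be pulled out of the image measure.\<close>
  have "distr \<mu> borel ?T = distr (density lborel (\<lambda>z. ?h (?T z))) borel ?T"
    by (simp add: uniform_measure_def indicator_def reflect_in_K_iff)
  also have "\<dots> = density (distr lborel borel ?T) ?h"
    by (rule density_distr[symmetric]) measurable
  also have "\<dots> = \<mu>" by (simp add: lborel uniform_measure_def)
  finally show ?thesis .
qed

text \<open>Substituting the reflection, which preserves \<open>\<mu>\<close>, turns the integral
  into its own negative.\<close>

lemma integral_odd_eq_0:
  fixes h :: "'a \<Rightarrow> 'a"
  assumes [measurable]: "h \<in> borel_measurable borel" and odd: "\<And>z. h (2 *\<^sub>R c - z) = - h z"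
  shows "(\<integral>z. h z \<partial>\<mu>) = 0"
proof -
  have "(\<integral>z. h z \<partial>\<mu>) = (\<integral>z. h z \<partial>distr \<mu> borel (\<lambda>z. 2 *\<^sub>R c - z))"
    by (simp add: uniform_measure_reflect)
  also have "\<dots> = (\<integral>z. h (2 *\<^sub>R c - z) \<partial>\<mu>)" by (rule integral_distr) auto
  also have "\<dots> = - (\<integral>z. h z \<partial>\<mu>)" by (simp add: odd)
  finally have "2 *\<^sub>R (\<integral>z. h z \<partial>\<mu>) = 0" by (simp add: scaleR_2 eq_neg_iff_add_eq_0)
  then show ?thesis by simp
qed

lemma mean_uniform: "(\<integral>z. z - c \<partial>\<mu>) = 0"
  by (rule integral_odd_eq_0) (auto simp: scaleR_2)

lemma mean_radial_projection: "(\<integral>z. \<rho> z - c \<partial>\<mu>) = 0"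
  by (rule integral_odd_eq_0) (simp_all add: radial_projection_reflect, simp add: scaleR_2)

end

section \<open>Squared distances of independent random points\<close>

text \<open>The subfamilies on the disjoint index sets \<open>{i}\<close> and \<open>{j}\<close> are
  independent; evaluation at the single index recovers each variable.\<close>

lemma (in prob_space) indep_var_of_indep_vars:
  assumes "indep_vars (\<lambda>_. N) X I" "i \<in> I" "j \<in> I" "i \<noteq> j"
  shows "indep_var N (X i) N (X j)"
proof -
  have "indep_var N ((\<lambda>f. f i) \<circ> (\<lambda>\<omega>. restrict (\<lambda>k. X k \<omega>) {i}))
                  N ((\<lambda>f. f j) \<circ> (\<lambda>\<omega>. restrict (\<lambda>k. X k \<omega>) {j}))"
    by (rule indep_var_compose[OF indep_var_restrict[OF assms(1)]]) (use assms in auto)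
  then show ?thesis by (simp add: comp_def)
qed

text \<open>Expanding the square leaves the cross term (U - c) \<bullet> (V - c). It is split into
  coordinates, where independence factorises each expectation, and the factor from \<open>U\<close>
  is zero. The bounds supply integrability.\<close>

lemma (in prob_space) expectation_dist_square_indep:
  fixes U V :: "'a \<Rightarrow> 'b::euclidean_space"
  assumes indep: "indep_var borel U borel V"
    and bdd: "AE \<omega> in M. norm (U \<omega> - c) \<le> R" "AE \<omega> in M. norm (V \<omega> - c) \<le> R"
    and mean: "expectation (\<lambda>\<omega>. U \<omega> - c) = 0"
  shows "expectation (\<lambda>\<omega>. (dist (U \<omega>) (V \<omega>))\<^sup>2)
    = expectation (\<lambda>\<omega>. (norm (U \<omega> - c))\<^sup>2) + expectation (\<lambda>\<omega>. (norm (V \<omega> - c))\<^sup>2)"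
proof -
  have [measurable]: "U \<in> borel_measurable M" "V \<in> borel_measurable M"
    using indep by (auto dest: indep_var_rv1 indep_var_rv2)
  have int: "integrable M (\<lambda>\<omega>. U \<omega> - c)" "integrable M (\<lambda>\<omega>. V \<omega> - c)"
    using bdd by (auto intro: integrable_const_bound)
  have sq: "integrable M (\<lambda>\<omega>. (norm (W \<omega> - c))\<^sup>2)"
    if [measurable]: "W \<in> borel_measurable M" and "AE \<omega> in M. norm (W \<omega> - c) \<le> R" for W
  proof (rule integrable_const_bound[where B = "R\<^sup>2"])
    show "AE \<omega> in M. norm ((norm (W \<omega> - c))\<^sup>2) \<le> R\<^sup>2"
      using that(2) by eventually_elim (simp add: power_mono)
  qed simp
  have prod: "integrable M (\<lambda>\<omega>. ((U \<omega> - c) \<bullet> b) * ((V \<omega> - c) \<bullet> b))"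
    "expectation (\<lambda>\<omega>. ((U \<omega> - c) \<bullet> b) * ((V \<omega> - c) \<bullet> b)) = 0" for b
  proof -
    have ind: "indep_var borel (\<lambda>\<omega>. (U \<omega> - c) \<bullet> b) borel (\<lambda>\<omega>. (V \<omega> - c) \<bullet> b)"
      by (rule indep_var_compose[OF indep, of "\<lambda>x. (x - c) \<bullet> b" _ "\<lambda>x. (x - c) \<bullet> b", unfolded comp_def]) auto
    have i: "integrable M (\<lambda>\<omega>. (U \<omega> - c) \<bullet> b)" "integrable M (\<lambda>\<omega>. (V \<omega> - c) \<bullet> b)"
      using int by (auto intro: integrable_inner_left)
    show "integrable M (\<lambda>\<omega>. ((U \<omega> - c) \<bullet> b) * ((V \<omega> - c) \<bullet> b))"
      by (rule indep_var_integrable[OF ind i])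
    have "expectation (\<lambda>\<omega>. (U \<omega> - c) \<bullet> b) = 0"
      using integral_inner_left[of b M "\<lambda>\<omega>. U \<omega> - c"] int mean by simp
    then show "expectation (\<lambda>\<omega>. ((U \<omega> - c) \<bullet> b) * ((V \<omega> - c) \<bullet> b)) = 0"
      by (simp add: indep_var_lebesgue_integral[OF ind i])
  qed
  have split: "(dist (U \<omega>) (V \<omega>))\<^sup>2 = (norm (U \<omega> - c))\<^sup>2 + (norm (V \<omega> - c))\<^sup>2
      - 2 * (\<Sum>b\<in>Basis. ((U \<omega> - c) \<bullet> b) * ((V \<omega> - c) \<bullet> b))" for \<omega>
  proof -
    have "(norm (x - y))\<^sup>2 = (norm x)\<^sup>2 + (norm y)\<^sup>2 - 2 * (x \<bullet> y)" for x y :: 'b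
      by (simp add: power2_norm_eq_inner algebra_simps inner_commute)
    from this[of "U \<omega> - c" "V \<omega> - c"] show ?thesis
      by (simp add: dist_norm euclidean_inner[of "U \<omega> - c" "V \<omega> - c"])
  qed
  show ?thesis
    unfolding split using sq[of U] sq[of V] bdd prod by simp
qed

theorem proposition2:
  fixes K :: "'a::euclidean_space set" and c :: 'a
    and M :: "'w measure" and X X' Y Y' :: "'w \<Rightarrow> 'a" and d :: real
  assumes "convex_body K"
    and "centrally_symmetric_about c K"
    and "prob_space M"
    and "prob_space.indep_vars M (\<lambda>_. borel) (\<lambda>i. [X, X', Y, Y'] ! i) {..<4}"
    and "distr M borel X = uniform_measure lborel K"
    and "distr M borel X' = uniform_measure lborel K"
    and "distr M borel Y = projective_distribution c K"
    and "distr M borel Y' = projective_distribution c K"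
  defines "d \<equiv> real DIM('a)"
  shows "prob_space.expectation M (\<lambda>\<omega>. (dist (X \<omega>) (X' \<omega>))\<^sup>2)
           = d / (d + 1) * prob_space.expectation M (\<lambda>\<omega>. (dist (X \<omega>) (Y \<omega>))\<^sup>2)
       \<and> d / (d + 1) * prob_space.expectation M (\<lambda>\<omega>. (dist (X \<omega>) (Y \<omega>))\<^sup>2)
           = 2 * d / (d + 2) * prob_space.expectation M (\<lambda>\<omega>. (dist c (Y \<omega>))\<^sup>2)
       \<and> 2 * d / (d + 2) * prob_space.expectation M (\<lambda>\<omega>. (dist c (Y \<omega>))\<^sup>2)
           = d / (d + 2) * prob_space.expectation M (\<lambda>\<omega>. (dist (Y \<omega>) (Y' \<omega>))\<^sup>2)"
proof -
  interpret prob_space M by fact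
  have K: "convex K" "compact K" "interior K \<noteq> {}"
    using assms(1) by (auto simp: convex_body_def)
  have refl: "2 *\<^sub>R c - z \<in> K" if "z \<in> K" for z
    using assms(2) that unfolding centrally_symmetric_about_def by blast
  obtain x where x: "x \<in> interior K" using K(3) by blast
  \<comment> \<open>The centre is the midpoint of the interior point \<open>x\<close> and its mirror
    image in \<open>K\<close>, hence interior by convexity.\<close>
  then have "2 *\<^sub>R c - x - (1 / 2) *\<^sub>R (2 *\<^sub>R c - x - x) \<in> interior K"
    using refl interior_subset by (intro mem_interior_convex_shrink[OF K(1)]) auto
  also have "2 *\<^sub>R c - x - (1 / 2) *\<^sub>R (2 *\<^sub>R c - x - x) = c"
    by (simp add: algebra_simps scaleR_2[symmetric])
  finally have c: "c \<in> interior K" .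
  interpret symmetric_convex_body K c
    by unfold_locales (use K c refl in auto)
  obtain R where R: "\<And>z. z \<in> K \<Longrightarrow> norm (z - c) \<le> R"
    using K_bounded_center by blast

  have indep: "indep_var borel ([X, X', Y, Y'] ! i) borel ([X, X', Y, Y'] ! j)"
    if "i < 4" "j < 4" "i \<noteq> j" for i j
    using indep_var_of_indep_vars[OF assms(4)] that by simp
  have XX': "indep_var borel X borel X'" using indep[of 0 1] by simp
  have XY: "indep_var borel X borel Y" using indep[of 0 2] by simp
  have YY': "indep_var borel Y borel Y'" using indep[of 2 3] by simp
  have [measurable]: "X \<in> borel_measurable M" "X' \<in> borel_measurable M"
      "Y \<in> borel_measurable M" "Y' \<in> borel_measurable M"
    using XX' YY' by (auto dest: indep_var_rv1 indep_var_rv2)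

  \<comment> \<open>\<open>?F\<close> is the second moment of \<open>Y\<close> about
    \<open>c\<close>; all four expectations become multiples of it.\<close>
  let ?F = "\<integral>z. (norm (\<rho> z - c))\<^sup>2 \<partial>\<mu>"
  have uniform: "AE \<omega> in M. norm (W \<omega> - c) \<le> R" "expectation (\<lambda>\<omega>. W \<omega> - c) = 0"
      "expectation (\<lambda>\<omega>. (norm (W \<omega> - c))\<^sup>2) = d / (d + 2) * ?F"
    if [measurable]: "W \<in> borel_measurable M" and W: "distr M borel W = \<mu>" for W
  proof -
    have "AE z in distr M borel W. norm (z - c) \<le> R"
      unfolding W using AE_in_K by eventually_elim (rule R)
    then show "AE \<omega> in M. norm (W \<omega> - c) \<le> R" by (subst (asm) AE_distr_iff) auto
    have "expectation (\<lambda>\<omega>. W \<omega> - c) = (\<integral>z. z - c \<partial>distr M borel W)"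
      by (simp add: integral_distr)
    then show "expectation (\<lambda>\<omega>. W \<omega> - c) = 0" by (simp add: W mean_uniform)
    have "expectation (\<lambda>\<omega>. (norm (W \<omega> - c))\<^sup>2) = (\<integral>z. (norm (z - c))\<^sup>2 \<partial>distr M borel W)"
      by (simp add: integral_distr)
    then show "expectation (\<lambda>\<omega>. (norm (W \<omega> - c))\<^sup>2) = d / (d + 2) * ?F"
      by (simp add: W second_moment_radial_projection d_def)
  qed
  have projective: "AE \<omega> in M. norm (W \<omega> - c) \<le> R" "expectation (\<lambda>\<omega>. W \<omega> - c) = 0"
      "expectation (\<lambda>\<omega>. (norm (W \<omega> - c))\<^sup>2) = ?F"
    if [measurable]: "W \<in> borel_measurable M" and W: "distr M borel W = projective_distribution c K" for W
  proof -
    have W': "distr M borel W = distr \<mu> borel \<rho>"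
      using W by (simp add: projective_distribution_def)
    have "AE z in distr M borel W. norm (z - c) \<le> R"
      unfolding W' using R radial_projection_in_K by (subst AE_distr_iff) auto
    then show "AE \<omega> in M. norm (W \<omega> - c) \<le> R" by (subst (asm) AE_distr_iff) auto
    have "expectation (\<lambda>\<omega>. W \<omega> - c) = (\<integral>z. z - c \<partial>distr M borel W)"
      by (simp add: integral_distr)
    then show "expectation (\<lambda>\<omega>. W \<omega> - c) = 0"
      by (simp add: W' integral_distr mean_radial_projection)
    have "expectation (\<lambda>\<omega>. (norm (W \<omega> - c))\<^sup>2) = (\<integral>z. (norm (z - c))\<^sup>2 \<partial>distr M borel W)"
      by (simp add: integral_distr)
    then show "expectation (\<lambda>\<omega>. (norm (W \<omega> - c))\<^sup>2) = ?F" by (simp add: W' integral_distr)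
  qed
  note X = uniform[OF _ assms(5)] and X' = uniform[OF _ assms(6)]
    and Y = projective[OF _ assms(7)] and Y' = projective[OF _ assms(8)]
  have "expectation (\<lambda>\<omega>. (dist (X \<omega>) (X' \<omega>))\<^sup>2) = d / (d + 2) * ?F + d / (d + 2) * ?F"
    using expectation_dist_square_indep[OF XX' X(1) X'(1) X(2)] X(3) X'(3) by simp
  moreover have "expectation (\<lambda>\<omega>. (dist (X \<omega>) (Y \<omega>))\<^sup>2) = d / (d + 2) * ?F + ?F"
    using expectation_dist_square_indep[OF XY X(1) Y(1) X(2)] X(3) Y(3) by simp
  moreover have "expectation (\<lambda>\<omega>. (dist (Y \<omega>) (Y' \<omega>))\<^sup>2) = ?F + ?F"
    using expectation_dist_square_indep[OF YY' Y(1) Y'(1) Y(2)] Y(3) Y'(3) by simp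
  moreover have "expectation (\<lambda>\<omega>. (dist c (Y \<omega>))\<^sup>2) = ?F"
    using Y(3) by (simp add: dist_norm norm_minus_commute)
  moreover have "d > 0" by (simp add: d_def)
  \<comment> \<open>Since d / (d + 2) + 1 = 2 (d + 1) / (d + 2), the factor d / (d + 1) cancels d +
    1 and leaves 2 d / (d + 2).\<close>
  then have "d / (d + 2) * ?F + d / (d + 2) * ?F = d / (d + 1) * (d / (d + 2) * ?F + ?F)"
      "d / (d + 1) * (d / (d + 2) * ?F + ?F) = 2 * d / (d + 2) * ?F"
    by (simp_all add: divide_simps, simp_all add: algebra_simps)
  ultimately show ?thesis by simp
qed

end
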